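(* Let $\mathcal X\subset\mathbb R^n$ be closed and convex, $A\in\mathbb R^{m\times n}$, $b\in\mathbb R^m$, $\beta\ge0$, and let $f\in\mathcal S^0_\mu(\mathcal X)$ with $\mu\ge0$. Let $(x^*,\lambda^* )$ be a KKT point of $\min_{x\in\mathcal X}f(x)$ s.t. $Ax=b$. Let $\theta_0=1$, $\gamma_0>0$, $(x_0,v_0)\in\mathcal X\times\mathbb R^n$, $\lambda_0\in\mathbb R^m$, and suppose that for all $k\in\mathbb N$, with $\alpha_k>0$ determined by $$\gamma_k\theta_k=\|A\|^2\alpha_k^2,$$ we have $$\frac{\theta_{k+1}-\theta_k}{\alpha_k}=-\theta_{k+1},\qquad\frac{\gamma_{k+1}-\gamma_k}{\alpha_k}=\mu_\beta-\gamma_{k+1},$$ and $(\lambda_k,x_k,v_k)$ satisfies the semi-implicit scheme $$\theta_k\frac{\lambda_{k+1}-\lambda_k}{\alpha_k}=Av_{k+1}-b,\qquad\frac{x_{k+1}-x_k}{\alpha_k}=v_{k+1}-x_{k+1},$$ $$\gamma_k\frac{v_{k+1}-v_k}{\alpha_k}\in\mu_\beta(x_{k+1}-v_{k+1})-\big(\partial f_\beta(x_{k+1})+N_{\mathcal X}(x_{k+1})+A^\top\widehat\lambda_k\big),\qquad \widehat\lambda_k=\lambda_k+\frac{\alpha_k}{\theta_k}(Av_k-b).$$ Define $$\mathcal E_k=\mathcal L_\beta(x_k,\lambda^* )-\mathcal L_\beta(x^*,\lambda_k)+\frac{\gamma_k}2\|v_k-x^*\|^2+\frac{\theta_k}2\|\lambda_k-\lambda^*\|^2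 .$$ Then $\{x_k\}\subset\mathcal X$ and $$\mathcal E_{k+1}-\mathcal E_k\le-\alpha_k\mathcal E_{k+1}\quad\text{for all }k\in\mathbb N.$$ Moreover, for all $k\in\mathbb N$, $$\|Ax_k-b\|\le\theta_k\mathcal R_0,\qquad 0\le\mathcal L(x_k,\lambda^* )-\mathcal L(x^*,\lambda_k)\le\theta_k\mathcal E_0,\qquad |f(x_k)-f(x^* )|\le\theta_k\big(\mathcal E_0+\mathcal R_0\|\lambda^*\|\big),$$ where $\mathcal R_0=\sqrt{2\mathcal E_0}+\|\lambda_0-\lambda^*\|+\|Ax_0-b\|$ and $$\theta_k\le\min\left\{\frac{Q}{\sqrt{\gamma_0}\,k+Q},\ \frac{Q^2}{(\sqrt{\gamma_{\min}}\,k+Q)^2}\right\},\qquad Q=3\|A\|+\sqrt{\gamma_{\max}},$$ with $\gamma_{\min}=\min\{\mu_\beta,\gamma_0\}$ and $\gamma_{\max}=\max\{\mu_\beta,\gamma_0\}$.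
   Context: $\|\cdot\|$ is the Euclidean norm on vectors and $\|A\|$ the spectral norm. $\mathcal S^0_\mu(\mathcal X)$ ($\mu\ge0$) is the class of proper, closed, convex functions $g:\mathbb R^n\to\mathbb R\cup\{+\infty\}$ with $g(y)\ge g(x)+\langle p,y-x\rangle+\frac\mu2\|y-x\|^2$ for all $x,y\in\mathcal X$ and $p\in\partial g(x)$ ($\partial g$ is the convex subdifferential). Standing assumptions: the domain of $f$ meets $\mathcal X$, $b\in A\mathcal X$, and a KKT point exists. Notation: $f_\beta(x)=f(x)+\frac\beta2\|Ax-b\|^2$; $\mathcal L_\beta(x,\lambda)=f_\beta(x)+\delta_{\mathcal X}(x)+\langle\lambda,Ax-b\rangle$ with $\delta_{\mathcal X}$ the indicator function ($0$ on $\mathcal X$, $+\infty$ elsewhere); $\mathcal L=\mathcal L_0$. $N_{\mathcal X}(x)=\{y:\langle y,z-x\rangle\le0\ \forall z\in\mathcal X\}$ for $x\in\mathcal X$, and $N_{\mathcal X}(x)=\emptyset$ for $x\notin\mathcal X$. $\mu_\beta=\mu+\beta\sigma_{\min}^2(A)$, where $\sigma_{\min}^2(A)$ is the smallest eigenvalue of $A^\top A$ (so $\sigma_{\min}(A)>0$ means full column rank). A KKT point $(x^*,\lambda^* )$ satisfies $x^*\in\mathcal X$, $Ax^*=b$ and $0\in\partial f(x^* )+N_{\mathcal X}(x^* )+A^\top\lambda^*$; it is a saddle point: $\mathcal L(x^*,\lambda)\le\mathcal L(x^*,\lambda^* )\le\mathcal L(x,\lambda^* )$ for all $x,\lambda$.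 Convention: since $f$ may take the value $+\infty$, inequalities are read in $(-\infty,+\infty]$, and the inequality $\mathcal E_{k+1}-\mathcal E_k\le-\alpha_k\mathcal E_{k+1}$ is understood as $(1+\alpha_k)\mathcal E_{k+1}\le\mathcal E_k$. *)

theory Defs
  imports "HOL-Analysis.Analysis"
begin

text \<open>Functions into \<open>(-\<infinity>, +\<infinity>]\<close> have type \<^typ>\<open>'a \<Rightarrow> ereal\<close>; the value \<open>-\<infinity>\<close> is excluded by
  properness.\<close>

definition proper_fun :: "('a \<Rightarrow> ereal) \<Rightarrow> bool" where
  "proper_fun g \<longleftrightarrow> (\<forall>x. g x \<noteq> -\<infinity>) \<and> (\<exists>x. g x \<noteq> \<infinity>)"

definition effective_domain :: "('a \<Rightarrow> ereal) \<Rightarrow> 'a set" where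
  "effective_domain g = {x. g x < \<infinity>}"

text \<open>The library's \<open>epigraph\<close> is restricted to real-valued functions. As usual for extended-valued
  functions, convexity and closedness of \<open>g\<close> are those of its epigraph.\<close>

definition ext_epigraph :: "('a \<Rightarrow> ereal) \<Rightarrow> ('a \<times> real) set" where
  "ext_epigraph g = {(x, r). g x \<le> ereal r}"

text \<open>If \<open>g\<close> is proper, the subdifferential is empty wherever \<open>g\<close> is \<open>+\<infinity>\<close>.\<close>

definition subdifferential :: "('a::euclidean_space \<Rightarrow> ereal) \<Rightarrow> 'a \<Rightarrow> 'a set" where
  "subdifferential g x = {p. \<forall>y. g x + ereal (p \<bullet> (y - x)) \<le> g y}"

definition normal_cone :: "'a::euclidean_space set \<Rightarrow> 'a \<Rightarrow> 'a set" where
  "normal_cone X x = (if x \<in> X then {y. \<forall>z\<in>X. y \<bullet> (z - x) \<le> 0} else {})"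

definition indicator_fun :: "'a set \<Rightarrow> 'a \<Rightarrow> ereal" where
  "indicator_fun X x = (if x \<in> X then 0 else \<infinity>)"

text \<open>The class \<open>S\<^sup>0\<^sub>\<mu>(X)\<close>.\<close>

definition convex_class :: "real \<Rightarrow> 'a::euclidean_space set \<Rightarrow> ('a \<Rightarrow> ereal) set" where
  "convex_class \<mu> X = {g. proper_fun g \<and> closed (ext_epigraph g) \<and> convex (ext_epigraph g) \<and>
     (\<forall>x\<in>X. \<forall>y\<in>X. \<forall>p\<in>subdifferential g x.
        g x + ereal (p \<bullet> (y - x)) + ereal (\<mu> / 2 * (norm (y - x))\<^sup>2) \<le> g y)}"

definition is_eigenvalue :: "real^'n^'n \<Rightarrow> real \<Rightarrow> bool" where
  "is_eigenvalue M e \<longleftrightarrow> (\<exists>v. v \<noteq> 0 \<and> M *v v = e *\<^sub>R v)"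

definition sigma_min_sq :: "real^'n^'m \<Rightarrow> real" where
  "sigma_min_sq A = (LEAST e. is_eigenvalue (transpose A ** A) e)"

definition spectral_norm :: "real^'n^'m \<Rightarrow> real" where
  "spectral_norm A = onorm (\<lambda>x. A *v x)"

definition penalized ::
    "(real^'n \<Rightarrow> ereal) \<Rightarrow> real^'n^'m \<Rightarrow> real^'m \<Rightarrow> real \<Rightarrow> real^'n \<Rightarrow> ereal" where
  "penalized f A b \<beta> x = f x + ereal (\<beta> / 2 * (norm (A *v x - b))\<^sup>2)"

definition aug_lagrangian ::
    "(real^'n \<Rightarrow> ereal) \<Rightarrow> (real^'n) set \<Rightarrow> real^'n^'m \<Rightarrow> real^'m \<Rightarrow> real
      \<Rightarrow> real^'n \<Rightarrow> real^'m \<Rightarrow> ereal" where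
  "aug_lagrangian f X A b \<beta> x l =
     penalized f A b \<beta> x + indicator_fun X x + ereal (l \<bullet> (A *v x - b))"

definition lagrangian ::
    "(real^'n \<Rightarrow> ereal) \<Rightarrow> (real^'n) set \<Rightarrow> real^'n^'m \<Rightarrow> real^'m
      \<Rightarrow> real^'n \<Rightarrow> real^'m \<Rightarrow> ereal" where
  "lagrangian f X A b = aug_lagrangian f X A b 0"

definition kkt_point ::
    "(real^'n \<Rightarrow> ereal) \<Rightarrow> (real^'n) set \<Rightarrow> real^'n^'m \<Rightarrow> real^'m
      \<Rightarrow> real^'n \<Rightarrow> real^'m \<Rightarrow> bool" where
  "kkt_point f X A b x l \<longleftrightarrow> x \<in> X \<and> A *v x = b \<and>
     0 \<in> {p + q + transpose A *v l | p q. p \<in> subdifferential f x \<and> q \<in> normal_cone X x}"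

text \<open>Square root on \<open>[0, +\<infinity>]\<close>, used where the argument may be infinite; values at negative
  arguments are irrelevant.\<close>

definition ereal_sqrt :: "ereal \<Rightarrow> ereal" where
  "ereal_sqrt t = (if \<bar>t\<bar> = \<infinity> then t else ereal (sqrt (real_of_ereal t)))"

end

theory Submission
  imports Defs
begin

text \<open>
  The heart of the matter is the one-step inequality \<open>(1 + \<alpha>\<^sub>k) E\<^sub>k\<^sub>+\<^sub>1 \<le> E\<^sub>k\<close>
  (\<open>lyapunov_step\<close>). Multiplying by \<open>1 + \<alpha>\<^sub>k\<close> turns the parameter recursions into
  \<open>(1 + \<alpha>\<^sub>k) \<theta>\<^sub>k\<^sub>+\<^sub>1 = \<theta>\<^sub>k\<close> and \<open>(1 + \<alpha>\<^sub>k) \<gamma>\<^sub>k\<^sub>+\<^sub>1 = \<gamma>\<^sub>k + \<alpha>\<^sub>k \<mu>\<^sub>\<beta>\<close>. Expand the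
  differences of squares in \<open>E\<close> and insert the scheme. The subgradient terms
  \<open>\<langle>\<xi>, v\<^sub>k\<^sub>+\<^sub>1 - x\<^sup>*\<rangle>\<close> split, by \<open>\<alpha>\<^sub>k (v\<^sub>k\<^sub>+\<^sub>1 - x\<^sub>k\<^sub>+\<^sub>1) = x\<^sub>k\<^sub>+\<^sub>1 - x\<^sub>k\<close>, into one
  comparison of \<open>x\<^sub>k\<^sub>+\<^sub>1\<close> with \<open>x\<^sub>k\<close> and one with \<open>x\<^sup>*\<close>, both controlled by convexity. All terms in
  \<open>\<mu>\<^sub>\<beta>\<close> add up to a nonnegative square. The true multiplier \<open>\<lambda>\<^sub>k\<^sub>+\<^sub>1\<close> and its explicit prediction
  differ by \<open>(\<alpha>\<^sub>k / \<theta>\<^sub>k) A (v\<^sub>k - v\<^sub>k\<^sub>+\<^sub>1)\<close>; the resulting cross term is absorbed by the two squares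
  left over from \<open>v\<close> and \<open>\<lambda>\<close>, and that is exactly what the step size rule
  \<open>\<gamma>\<^sub>k \<theta>\<^sub>k = \<parallel>A\<parallel>\<^sup>2 \<alpha>\<^sub>k\<^sup>2\<close> is for.

  The convexity of the penalized objective with modulus \<open>\<mu> + \<beta> \<sigma>\<^sub>m\<^sub>i\<^sub>n\<^sup>2\<close>
  (\<open>penalized_strong_convexity\<close>) needs two ingredients: the smallest eigenvalue of \<open>A\<^sup>TA\<close> is the
  minimum of \<open>\<parallel>A z\<parallel>\<^sup>2\<close> on the unit sphere (\<open>sigma_min_sq_variational\<close>), and subtracting the gradient
  of the smooth penalty from a subgradient of the sum leaves a subgradient of \<open>f\<close>
  (\<open>subgradient_penalized\<close>).

  Iterating the one-step inequality gives \<open>E\<^sub>k \<le> \<theta>\<^sub>k E\<^sub>0\<close>. All parts of \<open>E\<^sub>k\<close> are nonnegative, the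
  Lagrangian gap because a KKT point is a saddle point, so each part is at most \<open>\<theta>\<^sub>k E\<^sub>0\<close>. The
  residual bound does not come from the penalty, which may be absent, but from an invariant: the
  scheme keeps \<open>\<lambda>\<^sub>k - (A x\<^sub>k - b) / \<theta>\<^sub>k\<close> constant, hence \<open>A x\<^sub>k - b\<close> is \<open>\<theta>\<^sub>k\<close> times
  \<open>\<lambda>\<^sub>k - \<lambda>\<^sub>0 + (A x\<^sub>0 - b)\<close>, and \<open>E\<^sub>k\<close> bounds the distance from \<open>\<lambda>\<^sub>k\<close> to \<open>\<lambda>\<^sup>*\<close>. Finally \<open>step_theta_rates\<close> shows that the increments of
  \<open>1 / \<theta>\<^sub>k\<close> and of \<open>1 / \<surd>\<theta>\<^sub>k\<close> are bounded below by constants.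
\<close>

section \<open>The smallest eigenvalue of the Gram matrix\<close>

lemma inner_transpose_matrix_vector:
  fixes A :: "real^'n^'m"
  shows "(transpose A *v w) \<bullet> z = w \<bullet> (A *v z)"
  by (simp add: transpose_matrix_vector dot_lmul_matrix)

lemma norm_matrix_vector_sq:
  fixes A :: "real^'n^'m"
  shows "(norm (A *v z))\<^sup>2 = ((transpose A ** A) *v z) \<bullet> z"
  by (simp only: power2_norm_eq_inner inner_transpose_matrix_vector flip: matrix_vector_mul_assoc)

lemma norm_sq_add:
  fixes a c :: "'a::real_inner"
  shows "(norm (a + c))\<^sup>2 = (norm a)\<^sup>2 + 2 * (a \<bullet> c) + (norm c)\<^sup>2"
  by (simp add: power2_norm_eq_inner inner_add_left inner_add_right inner_commute)

text \<open>A quadratic that vanishes at \<open>0\<close> and has its minimum there has no linear term. This is the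
  first-order optimality condition, in a form that avoids differentiation.\<close>

lemma nonneg_parabola_linear_coeff:
  fixes c d :: real
  assumes "\<And>t. 0 \<le> 2 * t * c + t\<^sup>2 * d"
  shows "c = 0"
proof (rule ccontr)
  assume "c \<noteq> 0"
  (* The witness t = - c / D makes the value at most - c^2 / D; adding 1 keeps D positive. *)
  let ?D = "\<bar>d\<bar> + 1"
  have "0 \<le> 2 * (- c / ?D) * c + (- c / ?D)\<^sup>2 * d" by (rule assms)
  also have "\<dots> \<le> 2 * (- c / ?D) * c + (- c / ?D)\<^sup>2 * ?D"
    by (intro add_left_mono mult_left_mono) auto
  also have "\<dots> = - (c\<^sup>2 / ?D)"
    by (simp add: power2_eq_square divide_simps) 
  finally show False
    using \<open>c \<noteq> 0\<close> by (simp add: divide_le_0_iff)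
qed

text \<open>By compactness \<open>\<parallel>A z\<parallel>\<^sup>2\<close> attains a minimum \<open>m\<close> on the unit sphere, at \<open>u\<close> say. The quadratic form
  \<open>\<parallel>A z\<parallel>\<^sup>2 - m \<parallel>z\<parallel>\<^sup>2\<close> is nonnegative and vanishes at \<open>u\<close>, so its gradient vanishes there, which
  makes \<open>u\<close> an eigenvector for \<open>m\<close>. Hence the least eigenvalue exists and is \<open>m\<close>.\<close>

lemma sigma_min_sq_variational:
  fixes A :: "real^'n^'m"
  shows sigma_min_sq_nonneg: "0 \<le> sigma_min_sq A"
    and sigma_min_sq_le: "sigma_min_sq A * (norm z)\<^sup>2 \<le> (norm (A *v z))\<^sup>2"
proof -
  have "\<exists>u\<in>sphere 0 1. \<forall>z\<in>sphere 0 1. (norm (A *v u))\<^sup>2 \<le> (norm (A *v z))\<^sup>2"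
  proof (rule continuous_attains_inf)
    show "sphere (0::real^'n) 1 \<noteq> {}" by simp
    show "continuous_on (sphere 0 1) (\<lambda>z. (norm (A *v z))\<^sup>2)"
      by (intro continuous_intros matrix_vector_mult_linear_continuous_on)
  qed simp
  then obtain u where u: "norm u = 1"
    and min: "\<And>z. norm z = 1 \<Longrightarrow> (norm (A *v u))\<^sup>2 \<le> (norm (A *v z))\<^sup>2"
    by auto
  define m where "m = (norm (A *v u))\<^sup>2"
  have le: "m * (norm z)\<^sup>2 \<le> (norm (A *v z))\<^sup>2" for z
  proof (cases "z = 0")
    case False
    have "m \<le> (norm (A *v (z /\<^sub>R norm z)))\<^sup>2"
      unfolding m_def using False by (intro min) simp
    also have "\<dots> = (norm (A *v z))\<^sup>2 / (norm z)\<^sup>2"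
      by (simp add: matrix_vector_mult_scaleR power_mult_distrib power_inverse divide_inverse_commute)
    finally show ?thesis
      using False by (simp add: pos_le_divide_eq)
  qed simp
  (* Perturb u in the direction of its own eigenvalue defect w: the linear term is then w \<bullet> w. *)
  define w where "w = (transpose A ** A) *v u - m *\<^sub>R u"
  have "0 \<le> 2 * t * (w \<bullet> w) + t\<^sup>2 * ((norm (A *v w))\<^sup>2 - m * (norm w)\<^sup>2)" for t
  proof -
    have uw: "(A *v u) \<bullet> (A *v w) - m * (u \<bullet> w) = w \<bullet> w"
      by (subst (3) w_def)
        (simp add: inner_diff_left dot_lmul_matrix flip: matrix_vector_mul_assoc)
    have "0 \<le> (norm (A *v (u + t *\<^sub>R w)))\<^sup>2 - m * (norm (u + t *\<^sub>R w))\<^sup>2"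
      using le by simp
    also have "\<dots> = ((norm (A *v u))\<^sup>2 - m * (norm u)\<^sup>2)
        + 2 * t * ((A *v u) \<bullet> (A *v w) - m * (u \<bullet> w))
        + t\<^sup>2 * ((norm (A *v w))\<^sup>2 - m * (norm w)\<^sup>2)"
      by (simp add: matrix_vector_right_distrib matrix_vector_mult_scaleR norm_sq_add
          power_mult_distrib ring_distribs ac_simps)
    finally show ?thesis
      unfolding uw by (simp add: u m_def)
  qed
  then have "w \<bullet> w = 0"
    by (rule nonneg_parabola_linear_coeff)
  then have eig: "is_eigenvalue (transpose A ** A) m"
    unfolding is_eigenvalue_def w_def using u by (intro exI[of _ u]) auto
  have "sigma_min_sq A = m"
    unfolding sigma_min_sq_def
  proof (rule Least_equality, rule eig)
    fix e assume "is_eigenvalue (transpose A ** A) e"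
    then obtain z where z: "z \<noteq> 0" "(transpose A ** A) *v z = e *\<^sub>R z"
      unfolding is_eigenvalue_def by blast
    have "m * (norm z)\<^sup>2 \<le> e * (norm z)\<^sup>2"
      using le[of z] norm_matrix_vector_sq[of A z] z(2) by (simp add: power2_norm_eq_inner)
    then show "m \<le> e" using z(1) by simp
  qed
  then show "0 \<le> sigma_min_sq A" "sigma_min_sq A * (norm z)\<^sup>2 \<le> (norm (A *v z))\<^sup>2"
    using le by (simp_all add: m_def)
qed

lemma norm_matrix_vector_le_spectral_norm:
  fixes A :: "real^'n^'m"
  shows "norm (A *v z) \<le> spectral_norm A * norm z"
  unfolding spectral_norm_def by (rule onorm) (rule matrix_vector_mul_bounded_linear)

section \<open>Subgradients of the penalized objective\<close>

lemma proper_finite_at_subgradient: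
  assumes "proper_fun g" and "p \<in> subdifferential g z"
  obtains r where "g z = ereal r"
proof -
  obtain y where "g y \<noteq> \<infinity>" using assms(1) unfolding proper_fun_def by blast
  moreover have "g z + ereal (p \<bullet> (y - z)) \<le> g y"
    using assms(2) unfolding subdifferential_def by blast
  moreover have "g z \<noteq> -\<infinity>"
    using assms(1) unfolding proper_fun_def by blast
  ultimately have "\<exists>r. g z = ereal r"
    by (cases "g z"; cases "g y") auto
  then show thesis using that by blast
qed

text \<open>The sum rule for a convex function plus a smooth one, in the direction needed here. Along the
  segment from \<open>z\<close> to \<open>y\<close> the subgradient inequality of the sum, divided by the length parameter
  \<open>t\<close>, has the penalty only through its derivative and a term of order \<open>t\<close>; convexity of \<open>f\<close>
  bounds its increment by \<open>t (f y - f z)\<close>, and \<open>t \<rightarrow> 0\<close> leaves the claim.\<close>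

lemma subgradient_penalized:
  fixes A :: "real^'n^'m"
  assumes conv: "convex (ext_epigraph f)"
    and p: "p \<in> subdifferential (penalized f A b \<beta>) z"
    and fz: "f z = ereal r" and fin: "\<And>y. f y \<noteq> -\<infinity>"
  shows "p - \<beta> *\<^sub>R (transpose A *v (A *v z - b)) \<in> subdifferential f z"
  unfolding subdifferential_def
proof (intro CollectI allI)
  fix y
  let ?d = "y - z"
  show "f z + ereal ((p - \<beta> *\<^sub>R (transpose A *v (A *v z - b))) \<bullet> ?d) \<le> f y"
  proof (cases "f y")
    case PInf then show ?thesis by simp
  next
    case MInf then show ?thesis using fin by simp
  next
    case (real s)
    define c where "c = s - r - p \<bullet> ?d + \<beta> * ((A *v z - b) \<bullet> (A *v ?d))"
    define e where "e = \<beta> / 2 * (norm (A *v ?d))\<^sup>2"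
    have main: "0 \<le> c + t * e" if t: "0 < t" "t < 1" for t
    proof -
      let ?y = "(1 - t) *\<^sub>R z + t *\<^sub>R y"
      have "(1 - t) *\<^sub>R (z, r) + t *\<^sub>R (y, s) \<in> ext_epigraph f"
        by (rule convexD[OF conv]) (use t fz real in \<open>auto simp: ext_epigraph_def\<close>)
      then have 1: "f ?y \<le> ereal ((1 - t) * r + t * s)"
        by (simp add: ext_epigraph_def)
      have "penalized f A b \<beta> z + ereal (p \<bullet> (?y - z)) \<le> penalized f A b \<beta> ?y"
        using p unfolding subdifferential_def by blast
      moreover have yz: "?y = z + t *\<^sub>R ?d" by (simp add: algebra_simps)
      ultimately have "r + \<beta> / 2 * (norm (A *v z - b))\<^sup>2 + t * (p \<bullet> ?d)
          \<le> (1 - t) * r + t * s + \<beta> / 2 * (norm (A *v (z + t *\<^sub>R ?d) - b))\<^sup>2"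
        using 1 fin[of ?y] fz unfolding penalized_def yz
        by (cases "f (z + t *\<^sub>R ?d)") auto
      also have "(norm (A *v (z + t *\<^sub>R ?d) - b))\<^sup>2 = (norm (A *v z - b))\<^sup>2
          + 2 * t * ((A *v z - b) \<bullet> (A *v ?d)) + t\<^sup>2 * (norm (A *v ?d))\<^sup>2"
      proof -
        have "A *v (z + t *\<^sub>R ?d) - b = (A *v z - b) + t *\<^sub>R (A *v ?d)"
          by (simp add: matrix_vector_right_distrib matrix_vector_mult_scaleR)
        then show ?thesis
          by (simp only: norm_sq_add) (simp add: power_mult_distrib)
      qed
      finally have "0 \<le> t * (c + t * e)"
        unfolding c_def e_def by (simp add: ring_distribs ac_simps power2_eq_square[of t])
      then show ?thesis using t(1) by (simp add: zero_le_mult_iff)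
    qed
    have "((\<lambda>t. c + t * e) \<longlongrightarrow> c + 0 * e) (at_right 0)"
      by (intro tendsto_intros)
    moreover have "eventually (\<lambda>t::real. 0 \<le> c + t * e) (at_right 0)"
      using eventually_at_right_less[of 0] eventually_at_right_real[of 0 1]
      by (auto elim!: eventually_mono intro: main)
    ultimately have "0 \<le> c + 0 * e"
      by (rule tendsto_lowerbound) simp
    then show ?thesis
      unfolding c_def fz real by (simp add: inner_diff_left dot_lmul_matrix)
  qed
qed

text \<open>The penalty is quadratic, so its second-order remainder is exactly
  \<open>\<beta>/2 \<parallel>A (y - z)\<parallel>\<^sup>2\<close>, and the least eigenvalue turns this into additional strong convexity.\<close>

lemma penalized_strong_convexity:
  fixes A :: "real^'n^'m"
  assumes f: "f \<in> convex_class \<mu> X" and \<beta>: "\<beta> \<ge> 0"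
    and p: "p \<in> subdifferential (penalized f A b \<beta>) z"
    and zy: "z \<in> X" "y \<in> X" and fin: "f z = ereal r" "f y = ereal s"
  shows "r + \<beta> / 2 * (norm (A *v z - b))\<^sup>2 + p \<bullet> (y - z)
      + (\<mu> + \<beta> * sigma_min_sq A) / 2 * (norm (y - z))\<^sup>2
    \<le> s + \<beta> / 2 * (norm (A *v y - b))\<^sup>2"
proof -
  let ?d = "y - z"
  let ?p = "p - \<beta> *\<^sub>R (transpose A *v (A *v z - b))"
  have "?p \<in> subdifferential f z"
    using f p fin(1) by (intro subgradient_penalized) (auto simp: convex_class_def proper_fun_def)
  then have "f z + ereal (?p \<bullet> ?d) + ereal (\<mu> / 2 * (norm ?d)\<^sup>2) \<le> f y"
    using f zy unfolding convex_class_def by blast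
  then have "r + (p \<bullet> ?d - \<beta> * ((A *v z - b) \<bullet> (A *v ?d))) + \<mu> / 2 * (norm ?d)\<^sup>2 \<le> s"
    by (simp add: fin inner_diff_left dot_lmul_matrix)
  moreover have "(norm (A *v y - b))\<^sup>2 =
      (norm (A *v z - b))\<^sup>2 + 2 * ((A *v z - b) \<bullet> (A *v ?d)) + (norm (A *v ?d))\<^sup>2"
  proof -
    have "A *v y - b = (A *v z - b) + A *v ?d" by (simp add: matrix_vector_mult_diff_distrib)
    then show ?thesis by (simp only: norm_sq_add)
  qed
  moreover have "\<beta> * (sigma_min_sq A * (norm ?d)\<^sup>2) \<le> \<beta> * (norm (A *v ?d))\<^sup>2"
    using \<beta> by (intro mult_left_mono sigma_min_sq_le)
  ultimately show ?thesis
    by (simp add: ring_distribs ac_simps add_divide_distrib)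
qed


section \<open>One step of the scheme\<close>

lemma norm_sq_diff_polarized:
  fixes a c :: "'a::real_inner"
  shows "(norm a)\<^sup>2 - (norm c)\<^sup>2 = (norm (a - c))\<^sup>2 - 2 * ((c - a) \<bullet> c)"
  by (simp add: power2_norm_eq_inner inner_diff_left inner_diff_right inner_commute)

text \<open>Primed letters are the new iterates, \<open>\<xi>\<close> is the sum of a subgradient at \<open>x'\<close> and a normal
  vector, and \<open>F\<close>, \<open>F'\<close>, \<open>Fs\<close> are the values of the penalized objective at \<open>x\<close>, \<open>x'\<close>, \<open>xs\<close>;
  convexity enters only through the last two hypotheses. The difference of the two sides of the
  claim is, after cancellation, at least the sum of the nonnegative quantities treated in
  \<open>m_part\<close> and \<open>quad\<close> below.\<close>

lemma lyapunov_step: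
  fixes A :: "real^'n^'m" and x x' v v' xs \<xi> :: "real^'n" and l l' ls lh b :: "real^'m"
    and \<alpha> \<theta> \<theta>' \<gamma> \<gamma>' m F F' Fs :: real
  assumes pos: "\<alpha> > 0" "\<theta> > 0" "m \<ge> 0"
    and size: "\<gamma> * \<theta> = (spectral_norm A)\<^sup>2 * \<alpha>\<^sup>2"
    and params: "(1 + \<alpha>) * \<theta>' = \<theta>" "(1 + \<alpha>) * \<gamma>' = \<gamma> + \<alpha> * m"
    and feasible: "A *v xs = b"
    and multiplier: "\<theta> *\<^sub>R (l' - l) = \<alpha> *\<^sub>R (A *v v' - b)"
    and primal: "x' - x = \<alpha> *\<^sub>R (v' - x')"
    and extrapolated: "lh = l + (\<alpha> / \<theta>) *\<^sub>R (A *v v - b)"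
    and velocity: "\<gamma> *\<^sub>R (v' - v) = \<alpha> *\<^sub>R (m *\<^sub>R (x' - v') - (\<xi> + transpose A *v lh))"
    and conv_old: "F' + \<xi> \<bullet> (x - x') \<le> F"
    and conv_opt: "F' + \<xi> \<bullet> (xs - x') + m / 2 * (norm (xs - x'))\<^sup>2 \<le> Fs"
  shows "(1 + \<alpha>) * (F' + ls \<bullet> (A *v x' - b) - Fs
        + \<gamma>' / 2 * (norm (v' - xs))\<^sup>2 + \<theta>' / 2 * (norm (l' - ls))\<^sup>2)
      \<le> F + ls \<bullet> (A *v x - b) - Fs + \<gamma> / 2 * (norm (v - xs))\<^sup>2 + \<theta> / 2 * (norm (l - ls))\<^sup>2"
proof -
  (* r drives the multiplier update; s is the error of the extrapolation, up to \<alpha> / \<theta>. *)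
  define r where "r = A *v v' - b"
  define s where "s = A *v (v - v')"
  have xi_split: "\<alpha> * (\<xi> \<bullet> (v' - xs)) = \<xi> \<bullet> (x' - x) + \<alpha> * (\<xi> \<bullet> (x' - xs))"
    unfolding primal by (simp add: inner_diff_right algebra_simps)
  have v_part: "\<gamma> / 2 * ((norm (v - xs))\<^sup>2 - (norm (v' - xs))\<^sup>2)
      = \<gamma> / 2 * (norm (v - v'))\<^sup>2 - \<alpha> * m * ((x' - v') \<bullet> (v' - xs))
        + \<alpha> * (\<xi> \<bullet> (v' - xs)) + \<alpha> * (lh \<bullet> r)"
  proof -
    have "\<gamma> * ((v' - v) \<bullet> (v' - xs)) = (\<gamma> *\<^sub>R (v' - v)) \<bullet> (v' - xs)" by simp
    also have "\<dots> = \<alpha> * m * ((x' - v') \<bullet> (v' - xs)) - \<alpha> * (\<xi> \<bullet> (v' - xs))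
        - \<alpha> * (lh \<bullet> (A *v (v' - xs)))"
      unfolding velocity
      by (simp only: inner_scaleR_left inner_diff_left[of "m *\<^sub>R (x' - v')"] inner_add_left
          inner_transpose_matrix_vector) (simp add: algebra_simps)
    also have "A *v (v' - xs) = r"
      by (simp add: r_def feasible matrix_vector_mult_diff_distrib)
    finally show ?thesis
      using norm_sq_diff_polarized[of "v - xs" "v' - xs"]
      by (simp add: right_diff_distrib)
  qed
  have l_diff: "l' - l = (\<alpha> / \<theta>) *\<^sub>R r"
    using arg_cong[OF multiplier, of "\<lambda>z. (1 / \<theta>) *\<^sub>R z"] pos(2) by (simp add: r_def)
  have l_part: "\<theta> / 2 * ((norm (l - ls))\<^sup>2 - (norm (l' - ls))\<^sup>2)
      = \<alpha>\<^sup>2 / (2 * \<theta>) * (norm r)\<^sup>2 - \<alpha> * (r \<bullet> (l' - ls))"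
  proof -
    have "(norm (l - l'))\<^sup>2 = (\<alpha> / \<theta>)\<^sup>2 * (norm r)\<^sup>2"
      by (subst norm_minus_commute) (simp add: l_diff power_mult_distrib power_divide)
    moreover have "(l' - l) \<bullet> (l' - ls) = (\<alpha> / \<theta>) * (r \<bullet> (l' - ls))"
      by (simp only: l_diff inner_scaleR_left)
    ultimately have "(norm (l - ls))\<^sup>2 - (norm (l' - ls))\<^sup>2
        = (\<alpha> / \<theta>)\<^sup>2 * (norm r)\<^sup>2 - 2 * ((\<alpha> / \<theta>) * (r \<bullet> (l' - ls)))"
      using norm_sq_diff_polarized[of "l - ls" "l' - ls"] by simp
    then show ?thesis using pos(2) by (simp add: field_simps power2_eq_square)
  qed
  have lin: "ls \<bullet> (A *v x - b) - (1 + \<alpha>) * (ls \<bullet> (A *v x' - b)) = - (\<alpha> * (ls \<bullet> r))"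
  proof -
    have "x = x' - \<alpha> *\<^sub>R (v' - x')" using primal by (simp add: algebra_simps)
    then have "A *v x = A *v x' - \<alpha> *\<^sub>R (A *v v' - A *v x')"
      by (simp add: matrix_vector_mult_diff_distrib matrix_vector_mult_scaleR)
    then show ?thesis by (simp add: r_def inner_diff_right inner_add_right ring_distribs)
  qed
  have lh_diff: "\<alpha> * (lh \<bullet> r) - \<alpha> * (r \<bullet> (l' - ls)) - \<alpha> * (ls \<bullet> r) = \<alpha>\<^sup>2 / \<theta> * (s \<bullet> r)"
  proof -
    have "lh - l' = (\<alpha> / \<theta>) *\<^sub>R (A *v v - b) - (l' - l)" by (simp add: extrapolated)
    also have "\<dots> = (\<alpha> / \<theta>) *\<^sub>R s"
      unfolding l_diff r_def s_def
      by (simp add: matrix_vector_mult_diff_distrib flip: scaleR_diff_right)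
    finally have "(lh - l') \<bullet> r = \<alpha> / \<theta> * (s \<bullet> r)" by simp
    then have "\<alpha> * ((lh - l') \<bullet> r) = \<alpha>\<^sup>2 / \<theta> * (s \<bullet> r)" by (simp add: power2_eq_square)
    then show ?thesis
      by (simp add: inner_diff_left inner_diff_right inner_commute[of r] algebra_simps)
  qed
  have m_part: "(norm (xs - x'))\<^sup>2 - (norm (v' - xs))\<^sup>2 - 2 * ((x' - v') \<bullet> (v' - xs))
      = (norm (x' - v'))\<^sup>2"
    by (simp add: power2_norm_eq_inner inner_diff_left inner_diff_right inner_commute)
  (* Complete the square to \<alpha>^2 / (2 \<theta>) |s + r|^2; the step size rule makes \<gamma> / 2 |v - v'|^2
     just large enough to pay for the missing |s|^2. *)
  have quad: "0 \<le> \<gamma> / 2 * (norm (v - v'))\<^sup>2 + \<alpha>\<^sup>2 / (2 * \<theta>) * (norm r)\<^sup>2 + \<alpha>\<^sup>2 / \<theta> * (s \<bullet> r)"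
  proof -
    have "(norm s)\<^sup>2 \<le> (spectral_norm A)\<^sup>2 * (norm (v - v'))\<^sup>2"
      unfolding s_def power_mult_distrib[symmetric]
      by (intro power_mono norm_matrix_vector_le_spectral_norm) simp
    then have "\<alpha>\<^sup>2 / (2 * \<theta>) * (norm s)\<^sup>2
        \<le> \<alpha>\<^sup>2 / (2 * \<theta>) * ((spectral_norm A)\<^sup>2 * (norm (v - v'))\<^sup>2)"
      using pos(2) by (intro mult_left_mono) auto
    also have "\<dots> = (((spectral_norm A)\<^sup>2 * \<alpha>\<^sup>2) / (2 * \<theta>)) * (norm (v - v'))\<^sup>2"
      by simp
    also have "\<dots> = \<gamma> / 2 * (norm (v - v'))\<^sup>2"
      using pos(2) by (simp flip: size)
    finally have "\<alpha>\<^sup>2 / (2 * \<theta>) * (norm s)\<^sup>2 \<le> \<gamma> / 2 * (norm (v - v'))\<^sup>2" .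
    moreover have "\<alpha>\<^sup>2 / (2 * \<theta>) * (norm (s + r))\<^sup>2 = \<alpha>\<^sup>2 / (2 * \<theta>) * (norm s)\<^sup>2
        + \<alpha>\<^sup>2 / (2 * \<theta>) * (norm r)\<^sup>2 + \<alpha>\<^sup>2 / \<theta> * (s \<bullet> r)"
      using pos(2)
      by (simp add: power2_norm_eq_inner inner_add_left inner_add_right inner_commute field_simps)
    moreover have "0 \<le> \<alpha>\<^sup>2 / (2 * \<theta>) * (norm (s + r))\<^sup>2"
      using pos(2) by simp
    ultimately show ?thesis by linarith
  qed
  have expand: "(1 + \<alpha>) * (F' + ls \<bullet> (A *v x' - b) - Fs
        + \<gamma>' / 2 * (norm (v' - xs))\<^sup>2 + \<theta>' / 2 * (norm (l' - ls))\<^sup>2)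
      = F' + \<alpha> * F' + (1 + \<alpha>) * (ls \<bullet> (A *v x' - b)) - Fs - \<alpha> * Fs
        + \<gamma> / 2 * (norm (v' - xs))\<^sup>2 + \<alpha> * m / 2 * (norm (v' - xs))\<^sup>2
        + \<theta> / 2 * (norm (l' - ls))\<^sup>2"
  proof -
    have "(1 + \<alpha>) * (\<gamma>' / 2 * (norm (v' - xs))\<^sup>2)
        = \<gamma> / 2 * (norm (v' - xs))\<^sup>2 + \<alpha> * m / 2 * (norm (v' - xs))\<^sup>2"
      using arg_cong[OF params(2), of "\<lambda>t. t / 2 * (norm (v' - xs))\<^sup>2"]
      by (simp add: add_divide_distrib distrib_right)
    moreover have "(1 + \<alpha>) * (\<theta>' / 2 * (norm (l' - ls))\<^sup>2) = \<theta> / 2 * (norm (l' - ls))\<^sup>2"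
      by (simp flip: params)
    moreover have dist: "(1 + \<alpha>) * (t1 + t2 - t3 + t4 + t5) = t1 + \<alpha> * t1 + (1 + \<alpha>) * t2 - t3 - \<alpha> * t3
        + (1 + \<alpha>) * t4 + (1 + \<alpha>) * t5" for t1 t2 t3 t4 t5 :: real
      by (simp add: algebra_simps)
    ultimately show ?thesis unfolding dist by linarith
  qed
  have m_scaled: "\<alpha> * m / 2 * (norm (xs - x'))\<^sup>2 - \<alpha> * m / 2 * (norm (v' - xs))\<^sup>2
      - \<alpha> * m * ((x' - v') \<bullet> (v' - xs)) = \<alpha> * m / 2 * (norm (x' - v'))\<^sup>2"
    unfolding m_part[symmetric] by (simp add: right_diff_distrib)
  have opt_scaled: "\<alpha> * F' - \<alpha> * (\<xi> \<bullet> (x' - xs)) + \<alpha> * m / 2 * (norm (xs - x'))\<^sup>2 \<le> \<alpha> * Fs"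
  proof -
    have "\<xi> \<bullet> (xs - x') = - (\<xi> \<bullet> (x' - xs))" by (simp add: inner_diff_right)
    then show ?thesis
      using mult_left_mono[OF conv_opt, of \<alpha>] pos(1) by (simp add: distrib_left right_diff_distrib)
  qed
  have "\<xi> \<bullet> (x - x') = - (\<xi> \<bullet> (x' - x))" by (simp add: inner_diff_right)
  moreover have "0 \<le> \<alpha> * m / 2 * (norm (x' - v'))\<^sup>2" using pos by simp
  ultimately show ?thesis
    using xi_split v_part l_part lin lh_diff m_scaled opt_scaled quad conv_old
    unfolding expand right_diff_distrib by linarith
qed

section \<open>Decay of the parameters\<close>

text \<open>The new \<open>\<gamma>\<close> is a convex combination of the old one and \<open>m\<close>, so it never leaves the interval
  between \<open>m\<close> and \<open>\<gamma> 0\<close>; and since \<open>\<theta>\<close> shrinks by the full factor \<open>1 + \<alpha>\<close>, the quotient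
  \<open>\<gamma> / \<theta>\<close> does not decrease.\<close>

lemma step_parameter_bounds:
  fixes \<alpha> \<gamma> \<theta> :: "nat \<Rightarrow> real" and m :: real
  assumes \<alpha>: "\<And>k. \<alpha> k > 0" and m: "m \<ge> 0"
    and start: "\<theta> 0 = 1" "\<gamma> 0 > 0"
    and \<theta>: "\<And>k. (1 + \<alpha> k) * \<theta> (Suc k) = \<theta> k"
    and \<gamma>: "\<And>k. (1 + \<alpha> k) * \<gamma> (Suc k) = \<gamma> k + \<alpha> k * m"
  shows "0 < \<theta> k" and "\<theta> k \<le> 1"
    and "min m (\<gamma> 0) \<le> \<gamma> k" and "\<gamma> k \<le> max m (\<gamma> 0)"
    and "\<gamma> 0 * \<theta> k \<le> \<gamma> k"
proof -
  have "0 < \<theta> k \<and> \<theta> k \<le> 1 \<and> min m (\<gamma> 0) \<le> \<gamma> k \<and> \<gamma> k \<le> max m (\<gamma> 0) \<and> \<gamma> 0 * \<theta> k \<le> \<gamma> k"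
  proof (induction k)
    case 0 then show ?case using start by simp
  next
    case (Suc k)
    have a: "0 < 1 + \<alpha> k" using \<alpha>[of k] by simp
    have "0 < (1 + \<alpha> k) * \<theta> (Suc k)" "(1 + \<alpha> k) * \<theta> (Suc k) \<le> (1 + \<alpha> k) * 1"
      using Suc \<alpha>[of k] by (simp_all add: \<theta>)
    moreover have IH: "min m (\<gamma> 0) \<le> \<gamma> k" "\<gamma> k \<le> max m (\<gamma> 0)" "\<gamma> 0 * \<theta> k \<le> \<gamma> k"
      using Suc by blast+
    have "\<alpha> k * min m (\<gamma> 0) \<le> \<alpha> k * m" "\<alpha> k * m \<le> \<alpha> k * max m (\<gamma> 0)" "0 \<le> \<alpha> k * m"
      using \<alpha>[of k] m by (auto intro!: mult_left_mono)
    then have "(1 + \<alpha> k) * min m (\<gamma> 0) \<le> (1 + \<alpha> k) * \<gamma> (Suc k)"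
      "(1 + \<alpha> k) * \<gamma> (Suc k) \<le> (1 + \<alpha> k) * max m (\<gamma> 0)"
      "(1 + \<alpha> k) * (\<gamma> 0 * \<theta> (Suc k)) \<le> (1 + \<alpha> k) * \<gamma> (Suc k)"
      using IH by (simp_all only: \<gamma> \<theta> mult.left_commute[of _ "\<gamma> 0"],
          simp_all only: distrib_right mult_1_left)
    ultimately show ?case
      using a by (simp only: zero_less_mult_pos mult_le_cancel_left_pos)
  qed
  then show "0 < \<theta> k" "\<theta> k \<le> 1" "min m (\<gamma> 0) \<le> \<gamma> k" "\<gamma> k \<le> max m (\<gamma> 0)" "\<gamma> 0 * \<theta> k \<le> \<gamma> k"
    by blast+
qed

text \<open>The step size rule reads \<open>N \<alpha> = \<surd>\<gamma> \<surd>\<theta>\<close>. Bounding \<open>\<gamma>\<close> below by \<open>\<gamma> 0 * \<theta>\<close> gives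
  \<open>\<alpha> \<ge> (\<surd>(\<gamma> 0) / N) \<theta>\<close>, a constant lower bound on the increment \<open>\<alpha> / \<theta>\<close> of \<open>1 / \<theta>\<close>. Bounding
  \<open>\<gamma>\<close> below by the minimum of \<open>m\<close> and \<open>\<gamma> 0\<close> gives in the same way a lower bound on the increment
  \<open>(\<surd>(1 + \<alpha>) - 1) / \<surd>\<theta>\<close> of \<open>1 / \<surd>\<theta>\<close>. The constant \<open>Q\<close> has to dominate \<open>N\<close> in the first case
  and \<open>N (\<surd>(1 + \<alpha>) + 1)\<close> in the second; the term with the maximum bounds \<open>N \<alpha>\<close>, as \<open>\<theta> \<le> 1\<close>.\<close>

lemma step_theta_rates:
  fixes \<alpha> \<gamma> \<theta> :: "nat \<Rightarrow> real" and m N :: real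
  assumes \<alpha>: "\<And>k. \<alpha> k > 0" and m: "m \<ge> 0" and N: "N \<ge> 0"
    and start: "\<theta> 0 = 1" "\<gamma> 0 > 0"
    and \<theta>: "\<And>k. (1 + \<alpha> k) * \<theta> (Suc k) = \<theta> k"
    and \<gamma>: "\<And>k. (1 + \<alpha> k) * \<gamma> (Suc k) = \<gamma> k + \<alpha> k * m"
    and size: "\<And>k. \<gamma> k * \<theta> k = N\<^sup>2 * (\<alpha> k)\<^sup>2"
    and Q: "Q = 3 * N + sqrt (max m (\<gamma> 0))"
  shows "\<theta> k \<le> Q / (sqrt (\<gamma> 0) * real k + Q)"
    and "\<theta> k \<le> Q\<^sup>2 / (sqrt (min m (\<gamma> 0)) * real k + Q)\<^sup>2"
proof -
  note bounds = step_parameter_bounds[where \<alpha> = \<alpha> and \<theta> = \<theta> and \<gamma> = \<gamma>, OF \<alpha> m start \<theta> \<gamma>]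
  have Qpos: "0 < Q" and QN: "N \<le> Q"
    using N m start(2) by (auto simp: Q less_max_iff_disj intro!: add_nonneg_pos)
  have size': "N * \<alpha> k = sqrt (\<gamma> k) * sqrt (\<theta> k)" for k
  proof -
    have "sqrt (\<gamma> k * \<theta> k) = N * \<alpha> k"
      using N \<alpha>[of k] by (simp add: size real_sqrt_mult)
    then show ?thesis by (simp add: real_sqrt_mult)
  qed
  have step1: "sqrt (\<gamma> 0) * \<theta> k \<le> Q * \<alpha> k" for k
  proof -
    have "sqrt (\<gamma> 0) * \<theta> k = sqrt (\<gamma> 0 * \<theta> k) * sqrt (\<theta> k)"
      using bounds(1)[of k] by (simp add: real_sqrt_mult)
    also have "\<dots> \<le> sqrt (\<gamma> k) * sqrt (\<theta> k)"
      using bounds(1,5)[of k] by (intro mult_right_mono) auto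
    also have "\<dots> \<le> Q * \<alpha> k"
      unfolding size'[symmetric] using QN \<alpha>[of k] by (intro mult_right_mono) auto
    finally show ?thesis .
  qed
  have step2: "sqrt (min m (\<gamma> 0)) * sqrt (\<theta> k) \<le> Q * (sqrt (1 + \<alpha> k) - 1)" for k
  proof -
    define s where "s = sqrt (1 + \<alpha> k)"
    have s: "1 \<le> s" and fac: "\<alpha> k = (s + 1) * (s - 1)"
      using \<alpha>[of k] by (simp_all add: s_def algebra_simps)
    have s_le: "s \<le> 1 + \<alpha> k"
      using s fac mult_right_mono[of 1 "s + 1" "s - 1"] by simp
    have "N * \<alpha> k \<le> sqrt (max m (\<gamma> 0)) * 1"
      unfolding size' using bounds(1,2,4)[of k] m by (intro mult_mono) (auto simp: le_max_iff_disj)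
    then have "N * (s + 1) \<le> Q"
      using mult_left_mono[OF s_le N] N by (simp add: Q algebra_simps)
    then have "N * (s + 1) * (s - 1) \<le> Q * (s - 1)"
      using s by (intro mult_right_mono) auto
    then have "N * \<alpha> k \<le> Q * (s - 1)" by (simp add: fac mult.assoc)
    moreover have "sqrt (min m (\<gamma> 0)) * sqrt (\<theta> k) \<le> sqrt (\<gamma> k) * sqrt (\<theta> k)"
      using bounds(1,3)[of k] by (intro mult_right_mono) (simp_all only: real_sqrt_le_iff real_sqrt_ge_0_iff less_imp_le)
    ultimately show ?thesis unfolding size' s_def by linarith
  qed
  (* Both rates are proved by induction with the denominators cleared. *)
  have "(sqrt (\<gamma> 0) * real k + Q) * \<theta> k \<le> Q"
  proof (induction k)
    case 0 then show ?case by (simp add: start)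
  next
    case (Suc k)
    have "(1 + \<alpha> k) * ((sqrt (\<gamma> 0) * real (Suc k) + Q) * \<theta> (Suc k))
        = (sqrt (\<gamma> 0) * real k + Q) * \<theta> k + sqrt (\<gamma> 0) * \<theta> k"
      by (simp add: \<theta>[of k, symmetric] algebra_simps)
    also have "\<dots> \<le> (1 + \<alpha> k) * Q"
      using Suc step1[of k] by (simp add: algebra_simps)
    finally show ?case using \<alpha>[of k] by simp
  qed
  moreover have "0 < sqrt (\<gamma> 0) * real k + Q"
    using Qpos start(2) by (intro add_nonneg_pos) auto
  ultimately show "\<theta> k \<le> Q / (sqrt (\<gamma> 0) * real k + Q)"
    by (simp add: pos_le_divide_eq mult.commute)
  have "(sqrt (min m (\<gamma> 0)) * real k + Q) * sqrt (\<theta> k) \<le> Q"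
  proof (induction k)
    case 0 then show ?case by (simp add: start)
  next
    case (Suc k)
    let ?g = "sqrt (min m (\<gamma> 0))"
    have "sqrt (1 + \<alpha> k) * ((?g * real (Suc k) + Q) * sqrt (\<theta> (Suc k)))
        = (?g * real k + Q + ?g) * sqrt ((1 + \<alpha> k) * \<theta> (Suc k))"
      by (simp only: real_sqrt_mult of_nat_Suc) (simp add: algebra_simps)
    also have "\<dots> = (?g * real k + Q) * sqrt (\<theta> k) + ?g * sqrt (\<theta> k)"
      unfolding \<theta> by (simp add: distrib_right)
    also have "\<dots> \<le> sqrt (1 + \<alpha> k) * Q"
      using Suc step2[of k] by (simp add: algebra_simps)
    finally show ?case using \<alpha>[of k] by (simp add: add_pos_pos)
  qed
  moreover have D: "0 < sqrt (min m (\<gamma> 0)) * real k + Q"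
    using Qpos start(2) m by (intro add_nonneg_pos) auto
  ultimately have "((sqrt (min m (\<gamma> 0)) * real k + Q) * sqrt (\<theta> k))\<^sup>2 \<le> Q\<^sup>2"
    using bounds(1)[of k] by (intro power_mono) auto
  then show "\<theta> k \<le> Q\<^sup>2 / (sqrt (min m (\<gamma> 0)) * real k + Q)\<^sup>2"
    using D bounds(1)[of k]
    by (simp add: power_mult_distrib pos_le_divide_eq mult.commute)
qed

section \<open>Convergence of the scheme\<close>

lemma difference_quotientD:
  fixes w u :: "'a::real_vector"
  assumes "a > 0" and "c *\<^sub>R (w /\<^sub>R a) = u"
  shows "c *\<^sub>R w = a *\<^sub>R u"
  using assms(1) by (simp add: assms(2)[symmetric])

theorem theorem4p1:
  fixes f :: "real^'n \<Rightarrow> ereal" and X :: "(real^'n) set"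
    and A :: "real^'n^'m" and b :: "real^'m"
    and \<mu> \<beta> \<mu>\<^sub>\<beta> \<gamma>\<^sub>m\<^sub>i\<^sub>n \<gamma>\<^sub>m\<^sub>a\<^sub>x Q :: real
    and \<alpha> \<gamma> \<theta> :: "nat \<Rightarrow> real"
    and x v :: "nat \<Rightarrow> real^'n" and lam lamhat :: "nat \<Rightarrow> real^'m"
    and xs :: "real^'n" and lams :: "real^'m"
    and E :: "nat \<Rightarrow> ereal" and R\<^sub>0 :: ereal
  assumes "closed X" and "convex X"
    and "\<beta> \<ge> 0" and "\<mu> \<ge> 0"
    and "f \<in> convex_class \<mu> X"
    and "effective_domain f \<inter> X \<noteq> {}" and "b \<in> (\<lambda>z. A *v z) ` X"
    and "kkt_point f X A b xs lams"
    and "\<mu>\<^sub>\<beta> = \<mu> + \<beta> * sigma_min_sq A"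
    and "\<theta> 0 = 1" and "\<gamma> 0 > 0" and "x 0 \<in> X"
    and "\<And>k. \<alpha> k > 0"
    and "\<And>k. \<gamma> k * \<theta> k = (spectral_norm A)\<^sup>2 * (\<alpha> k)\<^sup>2"
    and "\<And>k. (\<theta> (Suc k) - \<theta> k) / \<alpha> k = - \<theta> (Suc k)"
    and "\<And>k. (\<gamma> (Suc k) - \<gamma> k) / \<alpha> k = \<mu>\<^sub>\<beta> - \<gamma> (Suc k)"
    and "\<And>k. \<theta> k *\<^sub>R ((lam (Suc k) - lam k) /\<^sub>R \<alpha> k) = A *v v (Suc k) - b"
    and "\<And>k. (x (Suc k) - x k) /\<^sub>R \<alpha> k = v (Suc k) - x (Suc k)"
    and "\<And>k. lamhat k = lam k + (\<alpha> k / \<theta> k) *\<^sub>R (A *v v k - b)"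
    and "\<And>k. \<gamma> k *\<^sub>R ((v (Suc k) - v k) /\<^sub>R \<alpha> k) \<in>
           {\<mu>\<^sub>\<beta> *\<^sub>R (x (Suc k) - v (Suc k)) - (p + q + transpose A *v lamhat k) | p q.
              p \<in> subdifferential (penalized f A b \<beta>) (x (Suc k)) \<and>
              q \<in> normal_cone X (x (Suc k))}"
    and "\<And>k. E k = aug_lagrangian f X A b \<beta> (x k) lams - aug_lagrangian f X A b \<beta> xs (lam k)
           + ereal (\<gamma> k / 2 * (norm (v k - xs))\<^sup>2) + ereal (\<theta> k / 2 * (norm (lam k - lams))\<^sup>2)"
    and "R\<^sub>0 = ereal_sqrt (2 * E 0) + ereal (norm (lam 0 - lams)) + ereal (norm (A *v x 0 - b))"
    and "Q = 3 * spectral_norm A + sqrt \<gamma>\<^sub>m\<^sub>a\<^sub>x"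
    and "\<gamma>\<^sub>m\<^sub>i\<^sub>n = min \<mu>\<^sub>\<beta> (\<gamma> 0)" and "\<gamma>\<^sub>m\<^sub>a\<^sub>x = max \<mu>\<^sub>\<beta> (\<gamma> 0)"
  shows "range x \<subseteq> X
    \<and> (\<forall>k. ereal (1 + \<alpha> k) * E (Suc k) \<le> E k)
    \<and> (\<forall>k. ereal (norm (A *v x k - b)) \<le> ereal (\<theta> k) * R\<^sub>0
        \<and> 0 \<le> lagrangian f X A b (x k) lams - lagrangian f X A b xs (lam k)
        \<and> lagrangian f X A b (x k) lams - lagrangian f X A b xs (lam k) \<le> ereal (\<theta> k) * E 0
        \<and> \<bar>f (x k) - f xs\<bar> \<le> ereal (\<theta> k) * (E 0 + R\<^sub>0 * ereal (norm lams))
        \<and> \<theta> k \<le> min (Q / (sqrt (\<gamma> 0) * real k + Q))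
                     (Q\<^sup>2 / (sqrt \<gamma>\<^sub>m\<^sub>i\<^sub>n * real k + Q)\<^sup>2))"
proof -
  note f = assms(5) and kkt = assms(8) and m_def = assms(9) and E_def = assms(21) and R0 = assms(22)
  have proper: "proper_fun f" and fin: "\<And>y. f y \<noteq> -\<infinity>"
    using f by (auto simp: convex_class_def proper_fun_def)
  have m: "\<mu>\<^sub>\<beta> \<ge> 0"
    unfolding m_def using assms(3,4) sigma_min_sq_nonneg[of A] by simp
  have \<alpha>: "\<alpha> k > 0" and a1: "1 + \<alpha> k > 0" for k using assms(13)[of k] by simp_all
  have \<theta>: "(1 + \<alpha> k) * \<theta> (Suc k) = \<theta> k" and \<gamma>: "(1 + \<alpha> k) * \<gamma> (Suc k) = \<gamma> k + \<alpha> k * \<mu>\<^sub>\<beta>" for k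
    using assms(15,16)[of k] \<alpha>[of k] by (simp_all add: field_simps)
  note bounds = step_parameter_bounds[where \<alpha> = \<alpha> and \<theta> = \<theta> and \<gamma> = \<gamma>, OF \<alpha> m assms(10,11) \<theta> \<gamma>]
  have lam_step: "\<theta> k *\<^sub>R (lam (Suc k) - lam k) = \<alpha> k *\<^sub>R (A *v v (Suc k) - b)" for k
    using \<alpha> assms(17) by (rule difference_quotientD)
  have x_step: "x (Suc k) - x k = \<alpha> k *\<^sub>R (v (Suc k) - x (Suc k))" for k
    using arg_cong[OF assms(18)[of k], of "\<lambda>z. \<alpha> k *\<^sub>R z"] \<alpha>[of k] by simp

  obtain ps qs where xs: "xs \<in> X" and feas: "A *v xs = b"
    and ps: "ps \<in> subdifferential f xs" and qs: "qs \<in> normal_cone X xs"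
    and stat: "0 = ps + qs + transpose A *v lams"
    using kkt unfolding kkt_point_def by blast
  obtain fs where fs: "f xs = ereal fs" using proper_finite_at_subgradient[OF proper ps] .
  (* Pairing the stationarity condition with y - xs eliminates the subgradient ps. *)
  have saddle: "fs \<le> r + lams \<bullet> (A *v y - b)" if y: "y \<in> X" "f y = ereal r" for y r
  proof -
    have "f xs + ereal (ps \<bullet> (y - xs)) \<le> f y"
      using ps unfolding subdifferential_def by blast
    then have "fs + ps \<bullet> (y - xs) \<le> r" by (simp add: fs y(2))
    moreover have "qs \<bullet> (y - xs) \<le> 0" using qs y(1) xs by (auto simp: normal_cone_def)
    moreover have "ps \<bullet> (y - xs) + qs \<bullet> (y - xs) + lams \<bullet> (A *v y - b) = 0"
      using arg_cong[OF stat, of "\<lambda>z. z \<bullet> (y - xs)"]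
      by (simp add: inner_add_left dot_lmul_matrix matrix_vector_mult_diff_distrib feas)
    ultimately show ?thesis by simp
  qed

  obtain p q where p: "\<And>k. p k \<in> subdifferential (penalized f A b \<beta>) (x (Suc k))"
    and q: "\<And>k. q k \<in> normal_cone X (x (Suc k))"
    and v_eq: "\<And>k. \<gamma> k *\<^sub>R ((v (Suc k) - v k) /\<^sub>R \<alpha> k)
      = \<mu>\<^sub>\<beta> *\<^sub>R (x (Suc k) - v (Suc k)) - (p k + q k + transpose A *v lamhat k)"
  proof -
    have "\<exists>p q. p \<in> subdifferential (penalized f A b \<beta>) (x (Suc k)) \<and> q \<in> normal_cone X (x (Suc k))
        \<and> \<gamma> k *\<^sub>R ((v (Suc k) - v k) /\<^sub>R \<alpha> k)
          = \<mu>\<^sub>\<beta> *\<^sub>R (x (Suc k) - v (Suc k)) - (p + q + transpose A *v lamhat k)" for k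
      using assms(20)[of k] by blast
    then show thesis using that by metis
  qed
  have v_step: "\<gamma> k *\<^sub>R (v (Suc k) - v k) = \<alpha> k *\<^sub>R
      (\<mu>\<^sub>\<beta> *\<^sub>R (x (Suc k) - v (Suc k)) - (p k + q k + transpose A *v lamhat k))" for k
    using \<alpha> v_eq by (rule difference_quotientD)
  have xX: "x k \<in> X" for k
  proof (cases k)
    case 0 then show ?thesis using assms(12) by simp
  next
    case (Suc j) then show ?thesis using q[of j] by (auto simp: normal_cone_def split: if_splits)
  qed
  (* Only the starting point may have an infinite objective value: a subgradient exists at every
     later iterate. *)
  have f_Suc: "\<exists>r. f (x (Suc k)) = ereal r" for k
  proof -
    have "proper_fun (penalized f A b \<beta>)"
      unfolding proper_fun_def penalized_def using fin fs by (auto intro!: exI[of _ xs])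
    then obtain r where "penalized f A b \<beta> (x (Suc k)) = ereal r"
      using proper_finite_at_subgradient p by blast
    then show ?thesis unfolding penalized_def by (cases "f (x (Suc k))") auto
  qed

  define P where "P k = \<beta> / 2 * (norm (A *v x k - b))\<^sup>2" for k
  define W where "W k = \<gamma> k / 2 * (norm (v k - xs))\<^sup>2 + \<theta> k / 2 * (norm (lam k - lams))\<^sup>2" for k
  have E_fin: "E k = ereal (r + P k + lams \<bullet> (A *v x k - b) - fs + W k)" if "f (x k) = ereal r" for k r
    using that xX[of k] xs
    by (simp add: E_def aug_lagrangian_def penalized_def indicator_fun_def fs feas P_def W_def)
  have E_inf: "E k = \<infinity>" if "f (x k) = \<infinity>" for k
    using that xX[of k] xs
    by (simp add: E_def aug_lagrangian_def penalized_def indicator_fun_def fs feas)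
  have P: "P k \<ge> 0" and W: "W k \<ge> \<theta> k / 2 * (norm (lam k - lams))\<^sup>2" "W k \<ge> 0" for k
  proof -
    have "0 < \<gamma> k"
      using mult_pos_pos[OF assms(11) bounds(1)[of k]] bounds(5)[of k] by linarith
    then show "P k \<ge> 0" "W k \<ge> \<theta> k / 2 * (norm (lam k - lams))\<^sup>2" "W k \<ge> 0"
      using assms(3) bounds(1)[of k] by (simp_all add: P_def W_def)
  qed

  have step: "ereal (1 + \<alpha> k) * E (Suc k) \<le> E k" for k
  proof (cases "f (x k)")
    case PInf then show ?thesis by (simp add: E_inf)
  next
    case MInf then show ?thesis using fin by simp
  next
    case (real r)
    obtain r' where r': "f (x (Suc k)) = ereal r'" using f_Suc by blast
    let ?g = "p k + q k"
    have nc: "q k \<bullet> (y - x (Suc k)) \<le> 0" if "y \<in> X" for y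
      using q[of k] that by (auto simp: normal_cone_def split: if_splits)
    have sc: "r' + P (Suc k) + ?g \<bullet> (y - x (Suc k)) + \<mu>\<^sub>\<beta> / 2 * (norm (y - x (Suc k)))\<^sup>2
        \<le> s + \<beta> / 2 * (norm (A *v y - b))\<^sup>2" if "y \<in> X" "f y = ereal s" for y s
      using penalized_strong_convexity[OF f assms(3) p xX that(1) r' that(2)] nc[OF that(1)]
      by (simp add: P_def m_def inner_add_left)
    have "(1 + \<alpha> k) * ((r' + P (Suc k)) + lams \<bullet> (A *v x (Suc k) - b) - fs
          + \<gamma> (Suc k) / 2 * (norm (v (Suc k) - xs))\<^sup>2
          + \<theta> (Suc k) / 2 * (norm (lam (Suc k) - lams))\<^sup>2)
        \<le> (r + P k) + lams \<bullet> (A *v x k - b) - fs + \<gamma> k / 2 * (norm (v k - xs))\<^sup>2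
          + \<theta> k / 2 * (norm (lam k - lams))\<^sup>2"
    proof (rule lyapunov_step[OF \<alpha> bounds(1) m assms(14) \<theta> \<gamma> feas lam_step x_step assms(19) v_step])
      have "0 \<le> \<mu>\<^sub>\<beta> / 2 * (norm (x k - x (Suc k)))\<^sup>2" using m by simp
      then show "r' + P (Suc k) + ?g \<bullet> (x k - x (Suc k)) \<le> r + P k"
        using sc[OF xX real] by (simp add: P_def)
      show "r' + P (Suc k) + ?g \<bullet> (xs - x (Suc k)) + \<mu>\<^sub>\<beta> / 2 * (norm (xs - x (Suc k)))\<^sup>2 \<le> fs"
        using sc[OF xs fs] by (simp add: feas)
    qed
    then show ?thesis
      by (simp add: E_fin[OF real] E_fin[OF r'] W_def add.assoc)
  qed

  (* The invariant: lam k - (A x_k - b) / \<theta> k keeps its initial value. *)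
  have residual: "A *v x k - b = \<theta> k *\<^sub>R (lam k - lam 0 + (A *v x 0 - b))" for k
  proof (induction k)
    case 0 then show ?case by (simp add: assms(10))
  next
    case (Suc k)
    have "x k = x (Suc k) - \<alpha> k *\<^sub>R (v (Suc k) - x (Suc k))"
      using x_step[of k] by (simp add: algebra_simps)
    then have Ax: "A *v x k = A *v x (Suc k) - \<alpha> k *\<^sub>R (A *v v (Suc k) - A *v x (Suc k))"
      by (simp add: matrix_vector_mult_diff_distrib matrix_vector_mult_scaleR)
    have "(1 + \<alpha> k) *\<^sub>R (\<theta> (Suc k) *\<^sub>R (lam (Suc k) - lam 0 + (A *v x 0 - b)))
        = \<theta> k *\<^sub>R ((lam (Suc k) - lam k) + (lam k - lam 0 + (A *v x 0 - b)))"
      by (simp only: scaleR_scaleR \<theta>) simp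
    also have "\<dots> = \<theta> k *\<^sub>R (lam (Suc k) - lam k) + \<theta> k *\<^sub>R (lam k - lam 0 + (A *v x 0 - b))"
      by (rule scaleR_add_right)
    also have "\<dots> = \<alpha> k *\<^sub>R (A *v v (Suc k) - b) + (A *v x k - b)"
      unfolding lam_step by (simp only: Suc)
    also have "\<dots> = (1 + \<alpha> k) *\<^sub>R (A *v x (Suc k) - b)"
      unfolding Ax by (simp add: algebra_simps)
    finally show ?case using a1[of k] by (metis less_irrefl scaleR_cancel_left)
  qed

  have gap: "lagrangian f X A b (x k) lams - lagrangian f X A b xs (lam k)
      = (if f (x k) = \<infinity> then \<infinity> else ereal (real_of_ereal (f (x k)) + lams \<bullet> (A *v x k - b) - fs))" for k
    using xX[of k] xs fin[of "x k"]
    by (cases "f (x k)")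
      (simp_all add: lagrangian_def aug_lagrangian_def penalized_def indicator_fun_def fs feas)
  have gap_nonneg: "0 \<le> lagrangian f X A b (x k) lams - lagrangian f X A b xs (lam k)" for k
    unfolding gap using saddle[OF xX, of k] fin[of "x k"] by (cases "f (x k)") auto

  have rate: "\<theta> k \<le> min (Q / (sqrt (\<gamma> 0) * real k + Q)) (Q\<^sup>2 / (sqrt \<gamma>\<^sub>m\<^sub>i\<^sub>n * real k + Q)\<^sup>2)" for k
  proof -
    have N: "0 \<le> spectral_norm A"
      unfolding spectral_norm_def by (intro onorm_pos_le matrix_vector_mul_bounded_linear)
    note rates = step_theta_rates[where \<alpha> = \<alpha> and \<theta> = \<theta> and \<gamma> = \<gamma>, OF \<alpha> m N assms(10,11) \<theta> \<gamma> assms(14)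
        assms(23)[unfolded assms(25)]]
    show ?thesis using rates[of k] by (simp add: assms(24))
  qed

  have final: "ereal (norm (A *v x k - b)) \<le> ereal (\<theta> k) * R\<^sub>0
      \<and> lagrangian f X A b (x k) lams - lagrangian f X A b xs (lam k) \<le> ereal (\<theta> k) * E 0
      \<and> \<bar>f (x k) - f xs\<bar> \<le> ereal (\<theta> k) * (E 0 + R\<^sub>0 * ereal (norm lams))" for k
  proof (cases "f (x 0)")
    case MInf then show ?thesis using fin by simp
  next
    (* Here E 0 is infinite, so all upper bounds are trivial. *)
    case PInf
    have "R\<^sub>0 = \<infinity>" by (simp add: R0 E_inf[OF PInf] ereal_sqrt_def)
    then show ?thesis
      using bounds(1)[of k] by (simp add: E_inf[OF PInf])
  next
    case (real r0)
    define e0 where "e0 = r0 + P 0 + lams \<bullet> (A *v x 0 - b) - fs + W 0"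
    define R where "R = sqrt (2 * e0) + norm (lam 0 - lams) + norm (A *v x 0 - b)"
    have E0: "E 0 = ereal e0" unfolding e0_def by (rule E_fin[OF real])
    have R0': "R\<^sub>0 = ereal R" by (simp add: R0 E0 ereal_sqrt_def R_def)
    have decay: "E k \<le> ereal (\<theta> k * e0)"
    proof (induction k)
      case 0 then show ?case by (simp add: E0 assms(10))
    next
      case (Suc k)
      obtain r' where "f (x (Suc k)) = ereal r'" using f_Suc by blast
      then obtain e' where e': "E (Suc k) = ereal e'" using E_fin by blast
      have "ereal (1 + \<alpha> k) * E (Suc k) \<le> ereal (\<theta> k * e0)" using step Suc by (rule order_trans)
      then have "(1 + \<alpha> k) * e' \<le> (1 + \<alpha> k) * (\<theta> (Suc k) * e0)"
        by (simp add: e' mult.assoc[symmetric] \<theta>)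
      then show ?case using a1[of k] by (simp add: e')
    qed
    obtain r where r: "f (x k) = ereal r"
      using real f_Suc by (cases k) auto
    define g where "g = r + lams \<bullet> (A *v x k - b) - fs"
    have g: "0 \<le> g" unfolding g_def using saddle[OF xX r] by simp
    have le: "P k + g + W k \<le> \<theta> k * e0"
      using decay by (simp add: E_fin[OF r] g_def)
    have dual: "norm (lam k - lams) \<le> sqrt (2 * e0)"
    proof -
      have "\<theta> k * (norm (lam k - lams))\<^sup>2 \<le> \<theta> k * (2 * e0)"
        using le P[of k] W[of k] g by simp
      then have "(norm (lam k - lams))\<^sup>2 \<le> 2 * e0" using bounds(1)[of k] by simp
      then show ?thesis by (rule real_le_rsqrt)
    qed
    have res: "norm (A *v x k - b) \<le> \<theta> k * R"
    proof -
      have "norm (lam k - lam 0 + (A *v x 0 - b)) \<le> norm (lam k - lam 0) + norm (A *v x 0 - b)"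
        by (rule norm_triangle_ineq)
      also have "norm (lam k - lam 0) \<le> norm (lam k - lams) + norm (lam 0 - lams)"
        using norm_triangle_ineq4[of "lam k - lams" "lam 0 - lams"] by simp
      finally have "norm (lam k - lam 0 + (A *v x 0 - b)) \<le> R" using dual by (simp add: R_def)
      then show ?thesis using bounds(1)[of k] by (subst residual) simp
    qed
    have "\<bar>r - fs\<bar> \<le> \<theta> k * (e0 + R * norm lams)"
    proof -
      have "\<bar>lams \<bullet> (A *v x k - b)\<bar> \<le> norm lams * norm (A *v x k - b)" by (rule Cauchy_Schwarz_ineq2)
      also have "\<dots> \<le> norm lams * (\<theta> k * R)" using res by (intro mult_left_mono) auto
      finally have "\<bar>lams \<bullet> (A *v x k - b)\<bar> \<le> \<theta> k * (R * norm lams)" by (simp add: ac_simps)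
      then show ?thesis using le g P[of k] W[of k] unfolding g_def by (simp add: distrib_left)
    qed
    then show ?thesis
      using res le P[of k] W(2)[of k]
      by (simp add: gap r fs E0 R0' g_def)
  qed
  note residual_bound = final[THEN conjunct1]
    and gap_bound = final[THEN conjunct2, THEN conjunct1]
    and value_bound = final[THEN conjunct2, THEN conjunct2]
  have "range x \<subseteq> X" using xX by blast
  then show ?thesis
    by (intro conjI allI step residual_bound gap_nonneg gap_bound value_bound rate)
qed

end
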